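(* For any $(\eta^+,\eta^-)$, there exists an algorithm that, for any $r\in[0,\bar p]$, computes the price curve $\tilde{\mathbf p}(r)$ (defined in the context from the parameters $a,b,\eta^+,\bar p,T,r$) by solving only $O(\ln T)$ systems of linear equations.
   Context: Setting: prices lie in $[0,\bar p]$, the horizon is $T$, and the expected demand at price $p$ and reference price $r$ is $D(p,r)=b-ap+\eta^+(r-p)^+-\eta^-(p-r)^+$ ($x^+=\max\{x,0\}$, $a>0$, $\eta^\pm\ge0$), assumed non-negative for all $p,r\in[0,\bar p]$; moreover $\frac{b}{2a}\le\bar p-c_0$ for a constant $c_0>0$. Let $C_1=\frac{\eta^+}{2(a+\eta^+)}$ and $C_2=\frac{b}{2(a+\eta^+)}$. For $k\in\{1,\dots,T\}$ put $r^{(k)}=\frac{r+(k-1)\bar p}{k}$ and let $S_k$ be the linear system in unknowns $p_k,\dots,p_T$: $$p_t=C_1\left(\frac{k\,r^{(k)}+\sum_{s=k}^{t-1}p_s}{t}+\sum_{s=t+1}^{T}\frac{p_s}{s}\right)+C_2,\qquad t=k,\dots,T.$$ Let $t^\dagger$ be the smallest $k$ such that $S_k$ has a solution in $[0,\bar p]^{T-k+1}$, and let $p^\dagger$ be the first coordinate of that solution. The price curve $\tilde{\mathbf p}(r)=(p_t)_{t\in[T]}$ is $$p_t=\begin{cases}\bar p, & t\in[1,t^\dagger-1],\\ p^\dagger, & t=t^\dagger,\\ p_{t-1}-\dfrac{\eta^+ r_{t-1}}{2(a+\eta^+)t+\eta^+}, & t\in[t^\dagger+1,T-1],\\ \dfrac{\eta^+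 r_T+b}{2(a+\eta^+)}, & t=T,\end{cases}\qquad r_t=\frac{r+\sum_{s=1}^{t-1}p_s}{t}.$$ *)

theory Defs
  imports Complex_Main "HOL-Library.Landau_Symbols"
begin

section \<open>The pricing model and the price curve\<close>

definition demand :: "real \<Rightarrow> real \<Rightarrow> real \<Rightarrow> real \<Rightarrow> real \<Rightarrow> real \<Rightarrow> real" where
  "demand a b \<eta>p \<eta>m p r = b - a * p + \<eta>p * max (r - p) 0 - \<eta>m * max (p - r) 0"

definition pricing_model ::
  "real \<Rightarrow> real \<Rightarrow> real \<Rightarrow> real \<Rightarrow> real \<Rightarrow> real \<Rightarrow> bool" where
  "pricing_model a b \<eta>p \<eta>m pbar c0 \<longleftrightarrow>
     a > 0 \<and> \<eta>p \<ge> 0 \<and> \<eta>m \<ge> 0 \<and> c0 > 0 \<and>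
     (\<forall>p\<in>{0..pbar}. \<forall>r\<in>{0..pbar}. demand a b \<eta>p \<eta>m p r \<ge> 0) \<and>
     b / (2 * a) \<le> pbar - c0"

definition C1 :: "real \<Rightarrow> real \<Rightarrow> real" where
  "C1 a \<eta>p = \<eta>p / (2 * (a + \<eta>p))"

definition C2 :: "real \<Rightarrow> real \<Rightarrow> real \<Rightarrow> real" where
  "C2 a b \<eta>p = b / (2 * (a + \<eta>p))"

definition r_shift :: "real \<Rightarrow> real \<Rightarrow> nat \<Rightarrow> real" where
  "r_shift pbar r k = (r + (real k - 1) * pbar) / real k"

text \<open>Only the values \<open>p k, \<dots>, p T\<close> matter.\<close>

definition solves_S ::
  "real \<Rightarrow> real \<Rightarrow> real \<Rightarrow> real \<Rightarrow> nat \<Rightarrow> real \<Rightarrow> nat \<Rightarrow> (nat \<Rightarrow> real) \<Rightarrow> bool" where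
  "solves_S a b \<eta>p pbar T r k p \<longleftrightarrow>
     (\<forall>t\<in>{k..T}. p t =
        C1 a \<eta>p * ((real k * r_shift pbar r k + (\<Sum>s\<in>{k..<t}. p s)) / real t
                   + (\<Sum>s\<in>{t+1..T}. p s / real s))
        + C2 a b \<eta>p)"

definition box_solves_S ::
  "real \<Rightarrow> real \<Rightarrow> real \<Rightarrow> real \<Rightarrow> nat \<Rightarrow> real \<Rightarrow> nat \<Rightarrow> (nat \<Rightarrow> real) \<Rightarrow> bool" where
  "box_solves_S a b \<eta>p pbar T r k p \<longleftrightarrow>
     solves_S a b \<eta>p pbar T r k p \<and> (\<forall>t\<in>{k..T}. p t \<in> {0..pbar})"

definition t_dagger :: "real \<Rightarrow> real \<Rightarrow> real \<Rightarrow> real \<Rightarrow> nat \<Rightarrow> real \<Rightarrow> nat" where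
  "t_dagger a b \<eta>p pbar T r =
     (LEAST k. k \<in> {1..T} \<and> (\<exists>p. box_solves_S a b \<eta>p pbar T r k p))"

definition p_dagger :: "real \<Rightarrow> real \<Rightarrow> real \<Rightarrow> real \<Rightarrow> nat \<Rightarrow> real \<Rightarrow> real" where
  "p_dagger a b \<eta>p pbar T r =
     (THE x. \<exists>p. box_solves_S a b \<eta>p pbar T r (t_dagger a b \<eta>p pbar T r) p \<and>
                 x = p (t_dagger a b \<eta>p pbar T r))"

text \<open>The inner sums are the reference prices \<open>r\<^bsub>t-1\<^esub>\<close> and \<open>r\<^bsub>T\<^esub>\<close>. Only the values at
  \<open>t \<in> {1..T}\<close> are meaningful.\<close>

function price_curve :: "real \<Rightarrow> real \<Rightarrow> real \<Rightarrow> real \<Rightarrow> nat \<Rightarrow> real \<Rightarrow> nat \<Rightarrow> real" where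
  "price_curve a b \<eta>p pbar T r t =
     (if t < t_dagger a b \<eta>p pbar T r then pbar
      else if t = t_dagger a b \<eta>p pbar T r then p_dagger a b \<eta>p pbar T r
      else if t < T then
        price_curve a b \<eta>p pbar T r (t - 1)
        - \<eta>p * ((r + (\<Sum>s\<in>{1..<t-1}. price_curve a b \<eta>p pbar T r s)) / real (t - 1))
          / (2 * (a + \<eta>p) * real t + \<eta>p)
      else
        (\<eta>p * ((r + (\<Sum>s\<in>{1..<T}. price_curve a b \<eta>p pbar T r s)) / real T) + b)
          / (2 * (a + \<eta>p)))"
  by pat_completeness auto
termination
  by (relation "measure (\<lambda>(a, b, \<eta>p, pbar, T, r, t). t)") auto

declare price_curve.simps [simp del]


section \<open>Algorithms: a real RAM with a linear-system solver\<close>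

text \<open>
  Programs act on index registers (natural numbers), real registers and real arrays. There are no
  constants other than natural numbers, and a real number influences an index register only
  through the outcome of a comparison.
\<close>

type_synonym vname = string

record state =
  idx :: "vname \<Rightarrow> nat"
  reg :: "vname \<Rightarrow> real"
  arr :: "vname \<Rightarrow> nat \<Rightarrow> real"

datatype nexp =
    NConst nat
  | NVar vname
  | NAdd nexp nexp
  | NSub nexp nexp
  | NDiv nexp nexp

datatype rexp =
    RNat nexp
  | RVar vname
  | RArr vname nexp
  | RAdd rexp rexp
  | RSub rexp rexp
  | RMul rexp rexp
  | RDiv rexp rexp
  | RIf bexp rexp rexp
and bexp =
    BNatLess nexp nexp
  | BRealLess rexp rexp
  | BNot bexp
  | BAnd bexp bexp

fun nval :: "nexp \<Rightarrow> state \<Rightarrow> nat" where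
  "nval (NConst n) s = n"
| "nval (NVar x) s = idx s x"
| "nval (NAdd e f) s = nval e s + nval f s"
| "nval (NSub e f) s = nval e s - nval f s"
| "nval (NDiv e f) s = nval e s div nval f s"

fun rval :: "rexp \<Rightarrow> state \<Rightarrow> real" and bval :: "bexp \<Rightarrow> state \<Rightarrow> bool" where
  "rval (RNat e) s = real (nval e s)"
| "rval (RVar x) s = reg s x"
| "rval (RArr x e) s = arr s x (nval e s)"
| "rval (RAdd e f) s = rval e s + rval f s"
| "rval (RSub e f) s = rval e s - rval f s"
| "rval (RMul e f) s = rval e s * rval f s"
| "rval (RDiv e f) s = rval e s / rval f s"
| "rval (RIf c e f) s = (if bval c s then rval e s else rval f s)"
| "bval (BNatLess e f) s = (nval e s < nval f s)"
| "bval (BRealLess e f) s = (rval e s < rval f s)"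
| "bval (BNot c) s = (\<not> bval c s)"
| "bval (BAnd c d) s = (bval c s \<and> bval d s)"

datatype com =
    Skip
  | NSet vname nexp
  | RSet vname rexp
  | ASet vname nexp rexp
  | Seq com com
  | If bexp com com
  | While bexp com
  | Solve vname vname vname vname nexp nexp rexp rexp

text \<open>
  \<open>Solve f x i j m n A d\<close> solves the linear system
  \<open>\<Sum>l = m..n. A(k, l) * y\<^sub>l = d(k)\<close>, \<open>k = m, \<dots>, n\<close>, in the unknowns \<open>y\<^sub>m, \<dots>, y\<^sub>n\<close>; the entry
  \<open>A(k, l)\<close> is the value of the expression \<open>A\<close> when the index registers \<open>i\<close> and \<open>j\<close> hold \<open>k\<close>
  and \<open>l\<close>, and likewise \<open>d(k)\<close> with \<open>i\<close> holding \<open>k\<close>. If the solution exists and is unique, it is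
  written to the cells \<open>m, \<dots>, n\<close> of the array \<open>x\<close> and the index register \<open>f\<close> becomes 1;
  otherwise only \<open>f\<close> changes, and becomes 0.
\<close>

definition lin_sol ::
  "state \<Rightarrow> vname \<Rightarrow> vname \<Rightarrow> nat \<Rightarrow> nat \<Rightarrow> rexp \<Rightarrow> rexp \<Rightarrow> (nat \<Rightarrow> real) \<Rightarrow> bool" where
  "lin_sol s i j m n A d y \<longleftrightarrow>
     (\<forall>k\<in>{m..n}.
        (\<Sum>l\<in>{m..n}. rval A (s\<lparr>idx := (idx s)(i := k, j := l)\<rparr>) * y l)
          = rval d (s\<lparr>idx := (idx s)(i := k)\<rparr>))"

definition unique_lin_sol ::
  "state \<Rightarrow> vname \<Rightarrow> vname \<Rightarrow> nat \<Rightarrow> nat \<Rightarrow> rexp \<Rightarrow> rexp \<Rightarrow> (nat \<Rightarrow> real) \<Rightarrow> bool" where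
  "unique_lin_sol s i j m n A d y \<longleftrightarrow>
     lin_sol s i j m n A d y \<and>
     (\<forall>z. lin_sol s i j m n A d z \<longrightarrow> (\<forall>l\<in>{m..n}. z l = y l))"

text \<open>
  \<open>exec c s ds n s'\<close>: started in \<open>s\<close>, the program \<open>c\<close> terminates in \<open>s'\<close>; \<open>ds\<close> lists, in
  chronological order, the numbers of unknowns of the linear systems it has solved, and \<open>n\<close> is its
  number of elementary steps. A step evaluates at most a constant number of expressions of the
  program text, so up to a factor depending only on the program \<open>n\<close> counts arithmetic operations
  and comparisons. (A \<open>Solve\<close> is recorded in \<open>ds\<close> and also counts as one step.)

  The length of \<open>ds\<close> alone would be a hollow measure: a program could carry out Gaussian
  elimination in elementary steps, or pack many systems into a single larger one. Hence \<open>ds\<close>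
  records the sizes of the systems, and \<open>n\<close> the work done outside the solver.
\<close>

inductive exec :: "com \<Rightarrow> state \<Rightarrow> nat list \<Rightarrow> nat \<Rightarrow> state \<Rightarrow> bool" where
  Skip: "exec Skip s [] 1 s"
| NSet: "exec (NSet x e) s [] 1 (s\<lparr>idx := (idx s)(x := nval e s)\<rparr>)"
| RSet: "exec (RSet x e) s [] 1 (s\<lparr>reg := (reg s)(x := rval e s)\<rparr>)"
| ASet: "exec (ASet x i e) s [] 1
           (s\<lparr>arr := (arr s)(x := (arr s x)(nval i s := rval e s))\<rparr>)"
| Seq: "exec c s ds n s' \<Longrightarrow> exec c' s' ds' n' s'' \<Longrightarrow>
          exec (Seq c c') s (ds @ ds') (n + n') s''"
| IfTrue: "bval e s \<Longrightarrow> exec c s ds n s' \<Longrightarrow> exec (If e c c') s ds (n + 1) s'"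
| IfFalse: "\<not> bval e s \<Longrightarrow> exec c' s ds n s' \<Longrightarrow> exec (If e c c') s ds (n + 1) s'"
| WhileFalse: "\<not> bval e s \<Longrightarrow> exec (While e c) s [] 1 s"
| WhileTrue: "bval e s \<Longrightarrow> exec c s ds n s' \<Longrightarrow> exec (While e c) s' ds' n' s'' \<Longrightarrow>
          exec (While e c) s (ds @ ds') (n + n' + 1) s''"
| SolveRegular: "unique_lin_sol s i j (nval m s) (nval n s) A d y \<Longrightarrow>
          exec (Solve f x i j m n A d) s [nval n s + 1 - nval m s] 1
            (s\<lparr>idx := (idx s)(f := 1),
               arr := (arr s)(x := (\<lambda>l. if l \<in> {nval m s..nval n s} then y l else arr s x l))\<rparr>)"
| SolveSingular: "(\<And>y. \<not> unique_lin_sol s i j (nval m s) (nval n s) A d y) \<Longrightarrow>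
          exec (Solve f x i j m n A d) s [nval n s + 1 - nval m s] 1
            (s\<lparr>idx := (idx s)(f := 0)\<rparr>)"

text \<open>Execution is deterministic, so a terminating execution is the only one.\<close>

inductive_cases exec_SkipE: "exec Skip s ds n s'"
inductive_cases exec_NSetE: "exec (NSet x e) s ds n s'"
inductive_cases exec_RSetE: "exec (RSet x e) s ds n s'"
inductive_cases exec_ASetE: "exec (ASet x i e) s ds n s'"
inductive_cases exec_SeqE: "exec (Seq c c') s ds n s'"
inductive_cases exec_IfE: "exec (If e c c') s ds n s'"
inductive_cases exec_WhileE: "exec (While e c) s ds n s'"
inductive_cases exec_SolveE: "exec (Solve f x i j m k A d) s ds n s'"

lemma exec_deterministic:
  "exec c s ds n s' \<Longrightarrow> exec c s ds' n' s'' \<Longrightarrow> ds' = ds \<and> n' = n \<and> s'' = s'"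
proof (induction arbitrary: ds' n' s'' rule: exec.induct)
  case (Seq c1 s ds1 n1 s1 c2 ds2 n2 s2)
  from Seq.prems show ?case
    by (rule exec_SeqE) (auto dest!: Seq.IH)
next
  case (IfTrue e s c ds n s1 c')
  from IfTrue.prems show ?case
    by (rule exec_IfE) (use IfTrue.hyps in \<open>auto dest!: IfTrue.IH\<close>)
next
  case (IfFalse e s c' ds n s1 c)
  from IfFalse.prems show ?case
    by (rule exec_IfE) (use IfFalse.hyps in \<open>auto dest!: IfFalse.IH\<close>)
next
  case (WhileFalse e s c)
  from WhileFalse.prems show ?case
    by (rule exec_WhileE) (use WhileFalse.hyps in auto)
next
  case (WhileTrue e s c ds1 n1 s1 ds2 n2 s2)
  from WhileTrue.prems show ?case
    by (rule exec_WhileE) (use WhileTrue.hyps(1) in \<open>auto dest!: WhileTrue.IH\<close>)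
next
  case (SolveRegular s i j m k A d y f x)
  from SolveRegular.prems show ?case
  proof (rule exec_SolveE, goal_cases)
    case (1 z)
    have "(\<lambda>l. if nval m s \<le> l \<and> l \<le> nval k s then z l else arr s x l) =
          (\<lambda>l. if l \<in> {nval m s..nval k s} then y l else arr s x l)"
      using SolveRegular.hyps 1(4) unfolding unique_lin_sol_def by (auto simp: fun_eq_iff)
    then show ?case by (simp only: 1(1-3)) simp
  next
    case 2
    from 2(4)[of y] SolveRegular.hyps show ?case by (rule notE)
  qed
next
  case (SolveSingular s i j m k A d f x)
  from SolveSingular.prems show ?case
  proof (rule exec_SolveE, goal_cases)
    case (1 z)
    from SolveSingular.hyps[of z] 1(4) show ?case by (rule notE)
  next
    case 2
    show ?case by (simp only: 2(1-3)) simp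
  qed
qed (auto elim: exec_SkipE exec_NSetE exec_RSetE exec_ASetE)


section \<open>Input and output convention\<close>

definition input_state ::
  "real \<Rightarrow> real \<Rightarrow> real \<Rightarrow> real \<Rightarrow> real \<Rightarrow> nat \<Rightarrow> real \<Rightarrow> state" where
  "input_state a b \<eta>p \<eta>m pbar T r =
     \<lparr>idx = (\<lambda>_. 0)(''T'' := T),
      reg = (\<lambda>_. 0)(''a'' := a, ''b'' := b, ''eta_plus'' := \<eta>p, ''eta_minus'' := \<eta>m,
                    ''pbar'' := pbar, ''r'' := r),
      arr = (\<lambda>_ _. 0)\<rparr>"

definition computes_price_curve ::
  "com \<Rightarrow> real \<Rightarrow> real \<Rightarrow> real \<Rightarrow> real \<Rightarrow> real \<Rightarrow> nat \<Rightarrow> real \<Rightarrow> nat list \<Rightarrow> nat \<Rightarrow> bool" where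
  "computes_price_curve P a b \<eta>p \<eta>m pbar T r ds n \<longleftrightarrow>
     (\<exists>s'. exec P (input_state a b \<eta>p \<eta>m pbar T r) ds n s' \<and>
           (\<forall>t\<in>{1..T}. arr s' ''p'' t = price_curve a b \<eta>p pbar T r t))"

end

theory Submission
  imports Defs
begin

text \<open>The price curve is \<open>pbar\<close> before \<open>t\<^sup>\<dagger>\<close> and the solution of the system
  \<open>S\<^sub>k\<close> with \<open>k = t\<^sup>\<dagger>\<close> afterwards, because subtracting consecutive equations of \<open>S\<^sub>k\<close>
  yields the recursion of the curve. The model assumptions force \<open>b > 0\<close>, so \<open>S\<^sub>k\<close> is the
  fixed-point equation of a monotone affine map with positive constant term; hence a solution with
  non-negative entries is the only solution, and one call of the solver decides whether \<open>S\<^sub>k\<close>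
  has a solution in the box. Solvability in the box passes from \<open>k\<close> to \<open>k + 1\<close> and holds for
  \<open>k = T\<close>, so bisection finds \<open>t\<^sup>\<dagger>\<close> with \<open>O(ln T)\<close> calls.\<close>

text \<open>Knaster-Tarski on the order interval from \<open>l\<close> to \<open>u\<close>: the
  pointwise supremum \<open>q\<close> of the subsolutions below \<open>u\<close> satisfies
  \<open>q \<le> F q\<close>, so \<open>F q\<close> is such a subsolution itself and
  \<open>F q \<le> q\<close>. All comparisons are made on \<open>I\<close> only.\<close>

lemma fixpoint_between:
  fixes F :: "('i \<Rightarrow> real) \<Rightarrow> 'i \<Rightarrow> real"
  assumes mono: "\<And>x y t. (\<And>s. s \<in> I \<Longrightarrow> x s \<le> y s) \<Longrightarrow> t \<in> I \<Longrightarrow> F x t \<le> F y t"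
    and le: "\<And>t. t \<in> I \<Longrightarrow> l t \<le> u t"
    and sub: "\<And>t. t \<in> I \<Longrightarrow> l t \<le> F l t"
    and super: "\<And>t. t \<in> I \<Longrightarrow> F u t \<le> u t"
  obtains q where "\<And>t. t \<in> I \<Longrightarrow> q t = F q t" "\<And>t. t \<in> I \<Longrightarrow> l t \<le> q t" "\<And>t. t \<in> I \<Longrightarrow> q t \<le> u t"
proof -
  define X where "X = {x. \<forall>t\<in>I. x t \<le> u t \<and> x t \<le> F x t}"
  define q where "q t = (SUP x\<in>X. x t)" for t
  have lX: "l \<in> X"
    using le sub by (auto simp: X_def)
  have bdd: "bdd_above ((\<lambda>x. x t) ` X)" if "t \<in> I" for t
    by (rule bdd_aboveI[of _ "u t"]) (use that in \<open>auto simp: X_def\<close>)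
  have upper: "x t \<le> q t" if "x \<in> X" "t \<in> I" for x t
    unfolding q_def using bdd that by (intro cSUP_upper) auto
  have least: "q t \<le> z" if "\<And>x. x \<in> X \<Longrightarrow> x t \<le> z" for t z
    unfolding q_def using lX that by (intro cSUP_least) auto
  have qu: "q t \<le> u t" if "t \<in> I" for t
    by (rule least) (use that in \<open>auto simp: X_def\<close>)
  have q1: "q t \<le> F q t" if t: "t \<in> I" for t
  proof (rule least)
    fix x assume x: "x \<in> X"
    then have "x t \<le> F x t" using t by (auto simp: X_def)
    also have "\<dots> \<le> F q t" using upper[OF x] t by (intro mono)
    finally show "x t \<le> F q t" .
  qed
  have "F q \<in> X"
    unfolding X_def
  proof (clarify, intro conjI)
    fix t assume t: "t \<in> I"
    have "F q t \<le> F u t" by (intro mono qu t)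
    also have "\<dots> \<le> u t" by (rule super[OF t])
    finally show "F q t \<le> u t" .
    show "F q t \<le> F (F q) t" by (intro mono q1 t)
  qed
  then have "F q t \<le> q t" if "t \<in> I" for t
    using upper that by blast
  with q1 qu upper[OF lX] show thesis
    by (intro that[of q]) (auto intro: antisym)
qed


section \<open>Monotone structure of the linear systems\<close>

text \<open>The demand assumptions and \<open>c0\<close> enter the analysis only through the strict
  inequalities \<open>b_pos\<close> and \<open>b_less\<close>: the first makes non-negative
  solutions strictly positive, the second keeps the solution of the last system inside the
  box.\<close>

locale pricing =
  fixes a b \<eta> pbar :: real and T :: nat and r :: real
  assumes a_pos: "a > 0" and eta_nonneg: "\<eta> \<ge> 0" and b_pos: "b > 0"
    and b_less: "b < 2 * a * pbar" and T_pos: "T \<ge> 1" and r_nonneg: "0 \<le> r" and r_le: "r \<le> pbar"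
begin

text \<open>The accumulated history \<open>K\<close> is a free parameter because the comparison
  arguments scale and shift it together with the prices.\<close>

definition step :: "real \<Rightarrow> nat \<Rightarrow> (nat \<Rightarrow> real) \<Rightarrow> nat \<Rightarrow> real" where
  "step K k p t = C1 a \<eta> * ((K + (\<Sum>s\<in>{k..<t}. p s)) / real t + (\<Sum>s\<in>{t+1..T}. p s / real s))
     + C2 a b \<eta>"

text \<open>For \<open>k \<ge> 1\<close> this is \<open>k * r_shift pbar r k\<close> with the
  division cancelled: the initial reference price plus \<open>k - 1\<close> prices equal to
  \<open>pbar\<close>.\<close>

definition hist :: "nat \<Rightarrow> real" where
  "hist k = r + (real k - 1) * pbar"

lemma C1_nonneg: "C1 a \<eta> \<ge> 0"
  using a_pos eta_nonneg by (simp add: C1_def)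

lemma C2_pos: "C2 a b \<eta> > 0"
  using a_pos eta_nonneg b_pos by (simp add: C2_def)

lemma pbar_pos: "pbar > 0"
proof -
  have "0 < 2 * a * pbar" using b_pos b_less by linarith
  then show ?thesis using a_pos by (simp add: zero_less_mult_iff)
qed

lemma hist_nonneg: "k \<ge> 1 \<Longrightarrow> hist k \<ge> 0"
  using r_nonneg pbar_pos by (simp add: hist_def)

lemma hist_Suc: "hist (Suc k) = hist k + pbar"
  by (simp add: hist_def algebra_simps)

lemma solves_S_iff:
  "k \<ge> 1 \<Longrightarrow> solves_S a b \<eta> pbar T r k p \<longleftrightarrow> (\<forall>t\<in>{k..T}. p t = step (hist k) k p t)"
  by (simp add: solves_S_def step_def r_shift_def hist_def)

lemma step_mono:
  assumes "K \<le> K'" "\<And>s. s \<in> {k..T} \<Longrightarrow> p s \<le> q s" "t \<in> {k..T}"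
  shows "step K k p t \<le> step K' k q t"
  unfolding step_def
  using assms C1_nonneg
  by (intro add_mono mult_left_mono divide_right_mono sum_mono) auto

text \<open>The map is affine in \<open>K\<close> and \<open>p\<close> jointly, with constant term
  \<open>C2\<close>. The correction vanishes when \<open>x + y = 1\<close>, and for a pure scaling
  with \<open>x > 1\<close> it has a favourable sign.\<close>

lemma step_affine:
  "step (x * K + y * K') k (\<lambda>s. x * p s + y * q s) t =
    x * step K k p t + y * step K' k q t + (1 - x - y) * C2 a b \<eta>"
proof -
  have 1: "(\<Sum>s\<in>A. x * p s + y * q s) = x * (\<Sum>s\<in>A. p s) + y * (\<Sum>s\<in>A. q s)" for A
    by (simp add: sum.distrib sum_distrib_left)
  have 2: "(\<Sum>s\<in>A. (x * p s + y * q s) / real s) = x * (\<Sum>s\<in>A. p s / real s) + y * (\<Sum>s\<in>A. q s / real s)" for A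
    by (simp add: sum.distrib sum_distrib_left add_divide_distrib)
  show ?thesis
    unfolding step_def 1 2 by (simp add: algebra_simps add_divide_distrib)
qed

lemma step_scale:
  "step (x * K) k (\<lambda>s. x * p s) t = x * step K k p t - (x - 1) * C2 a b \<eta>"
  using step_affine[of x K 0 0 k p p t] by (simp add: algebra_simps)

lemma solution_pos:
  assumes "K \<ge> 0" "\<And>t. t \<in> {k..T} \<Longrightarrow> p t = step K k p t" "\<And>t. t \<in> {k..T} \<Longrightarrow> 0 \<le> p t"
    "t \<in> {k..T}"
  shows "0 < p t"
proof -
  have "0 \<le> C1 a \<eta> * ((K + (\<Sum>s\<in>{k..<t}. p s)) / real t + (\<Sum>s\<in>{t+1..T}. p s / real s))"
    using assms C1_nonneg by (intro mult_nonneg_nonneg add_nonneg_nonneg divide_nonneg_nonneg sum_nonneg) auto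
  then have "0 < step K k p t"
    unfolding step_def using C2_pos by linarith
  then show ?thesis using assms(2,4) by simp
qed

text \<open>At a maximiser of \<open>q / p\<close> with value \<open>x > 1\<close>, the constant term \<open>C2 > 0\<close> would give
  \<open>q = step q \<le> step (x p) < x p\<close>.\<close>

lemma solution_le_nonneg_solution:
  assumes K: "K \<ge> 0" and p: "\<And>t. t \<in> {k..T} \<Longrightarrow> p t = step K k p t"
    and p0: "\<And>t. t \<in> {k..T} \<Longrightarrow> 0 \<le> p t"
    and q: "\<And>t. t \<in> {k..T} \<Longrightarrow> q t = step K k q t"
    and u: "u \<in> {k..T}"
  shows "q u \<le> p u"
proof -
  have pos: "0 < p t" if "t \<in> {k..T}" for t
    using solution_pos[OF K p p0 that] .
  define x where "x = Max ((\<lambda>t. q t / p t) ` {k..T})"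
  have "x \<in> (\<lambda>t. q t / p t) ` {k..T}"
    unfolding x_def using u by (intro Max_in) auto
  then obtain t where t: "t \<in> {k..T}" "x = q t / p t" by auto
  have le: "q s \<le> x * p s" if "s \<in> {k..T}" for s
  proof -
    have "q s / p s \<le> x" unfolding x_def using that by (intro Max_ge) auto
    then show ?thesis using pos[OF that] by (simp add: field_simps)
  qed
  have "x \<le> 1"
  proof (rule ccontr)
    assume "\<not> x \<le> 1"
    then have x: "x > 1" by simp
    have "K \<le> x * K" using x K mult_right_mono[of 1 x K] by simp
    then have "q t \<le> step (x * K) k (\<lambda>s. x * p s) t"
      unfolding q[OF t(1)] by (intro step_mono le t(1))
    also have "\<dots> = x * p t - (x - 1) * C2 a b \<eta>"
      using p[OF t(1)] by (simp add: step_scale)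
    also have "\<dots> < x * p t" using x C2_pos by simp
    finally show False using t pos[OF t(1)] by simp
  qed
  have "q u \<le> x * p u" by (rule le[OF u])
  also have "\<dots> \<le> 1 * p u" using \<open>x \<le> 1\<close> p0[OF u] by (intro mult_right_mono)
  finally show ?thesis by simp
qed

text \<open>One inequality is the previous comparison. For the other, the reflection
  \<open>2 * p - q\<close> is again a solution by affinity, and comparing it with \<open>p\<close>
  gives \<open>p \<le> q\<close>.\<close>

lemma solution_unique:
  assumes K: "K \<ge> 0" and p: "\<And>t. t \<in> {k..T} \<Longrightarrow> p t = step K k p t"
    and p0: "\<And>t. t \<in> {k..T} \<Longrightarrow> 0 \<le> p t"
    and q: "\<And>t. t \<in> {k..T} \<Longrightarrow> q t = step K k q t"
    and u: "u \<in> {k..T}"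
  shows "q u = p u"
proof (rule antisym)
  show "q u \<le> p u" by (rule solution_le_nonneg_solution[OF K p p0 q u])
  have "step K k (\<lambda>s. 2 * p s - q s) t = 2 * step K k p t - step K k q t" for t
    using step_affine[of 2 K "-1" K k p q t] by simp
  then have "2 * p u - q u \<le> p u"
    using p q u by (intro solution_le_nonneg_solution[OF K p p0, of "\<lambda>s. 2 * p s - q s"]) simp_all
  then show "p u \<le> q u" by simp
qed

text \<open>Here \<open>q\<close> ranges over all real solutions, which is the uniqueness that
  \<open>Solve\<close> tests.\<close>

lemma box_solution_unique:
  assumes "k \<ge> 1" "box_solves_S a b \<eta> pbar T r k p" "solves_S a b \<eta> pbar T r k q" "t \<in> {k..T}"
  shows "q t = p t"
  by (rule solution_unique[OF hist_nonneg[OF assms(1)], of k p q t])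
     (use assms in \<open>auto simp: box_solves_S_def solves_S_iff\<close>)

text \<open>Equations \<open>t\<close> and \<open>t - 1\<close> are subtracted: their tail sums
  differ only by \<open>p t / t\<close> and their history sums only by \<open>p (t - 1)\<close>. The
  result includes \<open>t = T\<close>, where the curve is instead given by the last
  equation.\<close>

lemma solution_recursion:
  assumes p: "\<And>t. t \<in> {k..T} \<Longrightarrow> p t = step K k p t" and t: "1 \<le> k" "k < t" "t \<le> T"
  shows "p t = p (t - 1) - \<eta> * ((K + (\<Sum>s\<in>{k..<t-1}. p s)) / real (t - 1)) / (2 * (a + \<eta>) * real t + \<eta>)"
proof -
  obtain n where n: "t = Suc n" "n \<ge> 1" "k \<le> n" using t by (cases t) auto
  define R where "R = K + (\<Sum>s\<in>{k..<n}. p s)"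
  define S where "S = (\<Sum>s\<in>{Suc t..T}. p s / real s)"
  define c where "c = C1 a \<eta>"
  have c: "c \<ge> 0" using C1_nonneg by (simp add: c_def)
  have c': "\<eta> = 2 * (a + \<eta>) * c" using a_pos eta_nonneg by (simp add: c_def C1_def field_simps)
  have s1: "K + (\<Sum>s\<in>{k..<Suc n}. p s) = R + p n" using n by (simp add: R_def)
  have s2: "(\<Sum>s\<in>{Suc n..T}. p s / real s) = p t / real t + S"
    using t n by (simp add: S_def sum.atLeast_Suc_atMost)
  have e1: "p t = c * ((R + p n) / real t + S) + C2 a b \<eta>"
    using p[of t] t n s1 by (simp add: step_def S_def c_def del: sum.op_ivl_Suc)
  have e2: "p n = c * (R / real n + (p t / real t + S)) + C2 a b \<eta>"
    using p[of n] t n s2 by (simp add: step_def R_def c_def)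
  have "p t - p n = c * ((R + p n) / real t - R / real n - p t / real t)"
    using e1 e2 by (simp add: algebra_simps)
  \<comment> \<open>The coefficient of \<open>R\<close> in the numerator is
    \<open>n - t = -1\<close>.\<close>
  also have "(R + p n) / real t - R / real n - p t / real t
      = (p n * real n - R - p t * real n) / (real n * real t)"
    using n by (simp add: divide_simps) (simp add: algebra_simps)
  finally have "p t - p n = c * (p n * real n - R - p t * real n) / (real n * real t)"
    by simp
  moreover have "real n * real t \<noteq> 0" using n by simp
  ultimately have "(p t - p n) * (real n * real t) = c * (p n * real n - R - p t * real n)"
    by (simp only: eq_divide_eq if_False not_False_eq_True simp_thms)
  \<comment> \<open>The right-hand side contains \<open>p t - p n\<close> again, with factor
    \<open>- c * n\<close>; collecting it on the left turns \<open>t\<close> into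
    \<open>t + c\<close>.\<close>
  then have "(p t - p n) * (real n * (real t + c)) = - (c * R)"
    using n by (simp add: algebra_simps)
  moreover have pos: "real t + c > 0" "real n > 0" using n c by auto
  ultimately have "p t - p n = - (c * R) / (real n * (real t + c))"
    by (subst eq_divide_eq) auto
  then have "p t = p n - c * R / (real n * (real t + c))" by simp
  \<comment> \<open>Expanding the fraction by \<open>2 * (a + \<eta>)\<close> and using
    \<open>c'\<close> produces the form in which the curve is defined.\<close>
  also have "c * R / (real n * (real t + c)) = \<eta> * (R / real n) / (2 * (a + \<eta>) * real t + \<eta>)"
  proof -
    have "2 * (a + \<eta>) * real t + \<eta> = 2 * (a + \<eta>) * (real t + c)"
      using c' by (simp add: algebra_simps)
    then have "\<eta> * (R / real n) / (2 * (a + \<eta>) * real t + \<eta>)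
        = 2 * (a + \<eta>) * (c * (R / real n)) / (2 * (a + \<eta>) * (real t + c))"
      using c' by (metis mult.assoc)
    also have "\<dots> = c * (R / real n) / (real t + c)"
      using a_pos eta_nonneg by (intro mult_divide_mult_cancel_left) simp
    finally show ?thesis by simp
  qed
  finally show ?thesis using n by (simp add: R_def)
qed

text \<open>The amount subtracted in the recursion is non-negative, so the prices decrease from
  \<open>k\<close> on.\<close>

lemma solution_le_first:
  assumes K: "K \<ge> 0" and p: "\<And>t. t \<in> {k..T} \<Longrightarrow> p t = step K k p t"
    and p0: "\<And>t. t \<in> {k..T} \<Longrightarrow> 0 \<le> p t" and k: "1 \<le> k"
  shows "k \<le> t \<Longrightarrow> t \<le> T \<Longrightarrow> p t \<le> p k"
proof (induction t rule: dec_induct)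
  case (step n)
  have "0 \<le> \<eta> * ((K + (\<Sum>s\<in>{k..<n}. p s)) / real n) / (2 * (a + \<eta>) * real (Suc n) + \<eta>)"
    using a_pos eta_nonneg K p0 step.hyps step.prems
    by (intro divide_nonneg_nonneg mult_nonneg_nonneg add_nonneg_nonneg sum_nonneg) auto
  then have "p (Suc n) \<le> p n"
    using solution_recursion[of k p K "Suc n", OF p] k step.hyps step.prems by simp
  with step.IH step.prems show ?case by simp
qed simp

text \<open>Replacing \<open>p k\<close> by \<open>pbar\<close> turns a solution \<open>p\<close> of \<open>S\<^sub>k\<close> into a subsolution of the next
  system, and its multiple \<open>(pbar / p k) p\<close> into a supersolution. The latter is at most
  \<open>pbar\<close> because \<open>p\<close> is decreasing.\<close>

lemma box_solvable_Suc:
  assumes k: "1 \<le> k" "k < T" and box: "box_solves_S a b \<eta> pbar T r k p"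
  shows "\<exists>q. box_solves_S a b \<eta> pbar T r (Suc k) q"
proof -
  have p: "p t = step (hist k) k p t" and p0: "0 \<le> p t" and p1: "p t \<le> pbar" if "t \<in> {k..T}" for t
    using box that k by (auto simp: box_solves_S_def solves_S_iff)
  have pk: "0 < p k" using solution_pos[OF hist_nonneg[OF k(1)] p p0] k by simp
  define x where "x = pbar / p k"
  have x: "x \<ge> 1" using p1[of k] pk k by (simp add: x_def)
  \<comment> \<open>Once \<open>y k\<close> is no longer an unknown, its contribution moves from the
    sum into the history; equation \<open>t > k\<close> is otherwise the same.\<close>
  have shift: "step (hist k + y k) (Suc k) y t = step (hist k) k y t" if "t \<in> {Suc k..T}" for y t
    using that by (simp add: step_def sum.atLeast_Suc_lessThan add.assoc)
  obtain q where q: "\<And>t. t \<in> {Suc k..T} \<Longrightarrow> q t = step (hist (Suc k)) (Suc k) q t"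
      "\<And>t. t \<in> {Suc k..T} \<Longrightarrow> p t \<le> q t" "\<And>t. t \<in> {Suc k..T} \<Longrightarrow> q t \<le> x * p t"
  proof (rule fixpoint_between[of "{Suc k..T}" "step (hist (Suc k)) (Suc k)" p "\<lambda>t. x * p t"])
    fix t assume t: "t \<in> {Suc k..T}"
    then have t': "t \<in> {k..T}" by auto
    show "p t \<le> x * p t" using mult_right_mono[OF x p0[OF t']] by simp
    have "p t = step (hist k + p k) (Suc k) p t" using p[OF t'] shift[OF t] by simp
    also have "\<dots> \<le> step (hist (Suc k)) (Suc k) p t"
      using p1[of k] k t by (intro step_mono) (auto simp: hist_Suc)
    finally show "p t \<le> step (hist (Suc k)) (Suc k) p t" .
    \<comment> \<open>The new history \<open>hist k + pbar\<close> is at most \<open>x\<close> times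
      the sum of \<open>hist k\<close> and \<open>p k\<close>, so the old system scaled by
      \<open>x\<close> dominates the new one.\<close>
    have "hist k \<le> x * hist k" using mult_right_mono[OF x hist_nonneg[OF k(1)]] by simp
    moreover have "x * p k = pbar" using pk by (simp add: x_def)
    ultimately have "step (hist (Suc k)) (Suc k) (\<lambda>t. x * p t) t \<le> step (x * (hist k + p k)) (Suc k) (\<lambda>t. x * p t) t"
      using t by (intro step_mono) (auto simp: hist_Suc algebra_simps)
    also have "\<dots> = x * p t - (x - 1) * C2 a b \<eta>"
      using p[OF t'] shift[OF t] by (simp add: step_scale)
    also have "\<dots> \<le> x * p t" using x C2_pos by simp
    finally show "step (hist (Suc k)) (Suc k) (\<lambda>t. x * p t) t \<le> x * p t" .
  qed (auto intro: step_mono)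
  have "0 \<le> q t \<and> q t \<le> pbar" if t: "t \<in> {Suc k..T}" for t
  proof -
    have "p t \<le> p k" using solution_le_first[OF hist_nonneg[OF k(1)] p p0 k(1), of t] t by simp
    then have "x * p t \<le> x * p k" using x by (intro mult_left_mono) auto
    also have "x * p k = pbar" using pk by (simp add: x_def)
    finally show ?thesis using q(2,3)[OF t] p0[of t] t by fastforce
  qed
  with q(1) have "box_solves_S a b \<eta> pbar T r (Suc k) q"
    by (auto simp: box_solves_S_def solves_S_iff)
  then show ?thesis by blast
qed

section \<open>The first solvable index and the price curve\<close>

definition solvable :: "nat \<Rightarrow> bool" where
  "solvable k \<longleftrightarrow> (\<exists>p. box_solves_S a b \<eta> pbar T r k p)"

lemma solvable_mono:
  assumes "1 \<le> k" "solvable k"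
  shows "k \<le> l \<Longrightarrow> l \<le> T \<Longrightarrow> solvable l"
proof (induction l rule: dec_induct)
  case (step n)
  then show ?case using assms(1) box_solvable_Suc[of n] by (auto simp: solvable_def)
qed (rule assms(2))

text \<open>For \<open>k = T\<close> both sums are empty and \<open>x\<close> is the explicit
  solution. It is at most \<open>pbar\<close> because \<open>hist T / T\<close> averages
  \<open>r\<close> with \<open>T - 1\<close> copies of \<open>pbar\<close> and because
  \<open>b < 2 * a * pbar\<close>. This supplies the initial upper end of the bisection.\<close>

lemma solvable_T: "solvable T"
proof -
  define x where "x = (\<eta> * (hist T / real T) + b) / (2 * (a + \<eta>))"
  have "hist T \<le> real T * pbar"
    using r_le by (simp add: hist_def algebra_simps)
  then have h: "0 \<le> hist T / real T" "hist T / real T \<le> pbar"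
    using T_pos hist_nonneg[OF T_pos] by (simp_all add: field_simps)
  have "0 \<le> x" 
    unfolding x_def using h a_pos eta_nonneg b_pos
    by (intro divide_nonneg_nonneg[of "_ + _"] add_nonneg_nonneg mult_nonneg_nonneg) auto
  moreover have "x \<le> pbar"
  proof -
    have "\<eta> * (hist T / real T) + b \<le> \<eta> * pbar + 2 * a * pbar"
      using mult_left_mono[OF h(2) eta_nonneg] b_less by linarith
    also have "\<dots> \<le> pbar * (2 * (a + \<eta>))"
      using pbar_pos eta_nonneg by (simp add: algebra_simps)
    finally show ?thesis unfolding x_def using a_pos eta_nonneg by (subst pos_divide_le_eq) auto
  qed
  moreover have "step (hist T) T (\<lambda>_. x) T = x"
    by (simp add: step_def x_def C1_def C2_def add_divide_distrib)
  ultimately have "box_solves_S a b \<eta> pbar T r T (\<lambda>_. x)"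
    using T_pos by (simp add: box_solves_S_def solves_S_iff)
  then show ?thesis unfolding solvable_def by blast
qed

lemma t_dagger_eq:
  assumes "1 \<le> k" "k \<le> T" "solvable k" "\<And>l. 1 \<le> l \<Longrightarrow> l < k \<Longrightarrow> \<not> solvable l"
  shows "t_dagger a b \<eta> pbar T r = k"
  unfolding t_dagger_def solvable_def[symmetric]
  by (rule Least_equality) (use assms in \<open>auto intro: leI\<close>)

text \<open>Strong induction, as each price refers to all earlier ones. At \<open>k\<close> the
  value is \<open>p_dagger\<close>, strictly between \<open>k\<close> and \<open>T\<close> the
  recursion applies, and a later \<open>T\<close> uses the last equation itself.\<close>

lemma price_curve_eq:
  assumes k: "1 \<le> k" "k \<le> T" "t_dagger a b \<eta> pbar T r = k"
    and box: "box_solves_S a b \<eta> pbar T r k p"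
  shows "t \<in> {1..T} \<Longrightarrow> price_curve a b \<eta> pbar T r t = (if t < k then pbar else p t)"
proof (induction t rule: less_induct)
  case (less t)
  let ?pc = "price_curve a b \<eta> pbar T r"
  have p: "p t = step (hist k) k p t" if "t \<in> {k..T}" for t
    using box that k by (auto simp: box_solves_S_def solves_S_iff)
  \<comment> \<open>Uniqueness of the box solution makes the definite description
    well-defined.\<close>
  have dagger: "p_dagger a b \<eta> pbar T r = p k"
    unfolding p_dagger_def k(3)
  proof (rule the_equality)
    show "\<exists>q. box_solves_S a b \<eta> pbar T r k q \<and> p k = q k" using box by blast
    fix x assume "\<exists>q. box_solves_S a b \<eta> pbar T r k q \<and> x = q k"
    then show "x = p k"
      using box_solution_unique[OF k(1) box, of _ k] k(2) by (auto simp: box_solves_S_def)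
  qed
  \<comment> \<open>By the induction hypothesis the curve contributes \<open>k - 1\<close> copies of
    \<open>pbar\<close>, exactly those inside \<open>hist k\<close>, and then values of
    \<open>p\<close>.\<close>
  have hist: "r + (\<Sum>s\<in>{1..<n}. ?pc s) = hist k + (\<Sum>s\<in>{k..<n}. p s)" if n: "k \<le> n" "n \<le> t" for n
  proof -
    have "(\<Sum>s\<in>{1..<n}. ?pc s) = (\<Sum>s\<in>{1..<n}. if s < k then pbar else p s)"
      using n less by (intro sum.cong) auto
    also have "\<dots> = (\<Sum>s\<in>{1..<k}. if s < k then pbar else p s) + (\<Sum>s\<in>{k..<n}. if s < k then pbar else p s)"
      using n k by (intro sum.atLeastLessThan_concat[symmetric]) auto
    also have "\<dots> = (real k - 1) * pbar + (\<Sum>s\<in>{k..<n}. p s)"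
      using k by (simp add: of_nat_diff)
    finally show ?thesis by (simp add: hist_def)
  qed
  consider "t < k" | "t = k" | "k < t" "t < T" | "k < t" "t = T"
    using less.prems by fastforce
  then show ?case
  proof cases
    case 1
    then show ?thesis using k by (subst price_curve.simps) simp
  next
    case 2
    then show ?thesis using k dagger by (subst price_curve.simps) simp
  next
    case 3
    then have "t - 1 < t" "t - 1 \<in> {1..T}" "\<not> t - 1 < k" using k by auto
    with less.IH have "?pc (t - 1) = p (t - 1)" by simp
    then show ?thesis
      using 3 k hist[of "t - 1"] solution_recursion[of k p "hist k" t, OF p]
      by (subst price_curve.simps) simp
  next
    case 4
    then show ?thesis
      using k hist[of t] p[of t]
      by (subst price_curve.simps) (simp add: step_def C1_def C2_def add_divide_distrib)
  qed
qed

end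


section \<open>Bisection for the first solvable system\<close>

definition C1_exp :: rexp where
  "C1_exp = RDiv (RVar ''eta_plus'')
     (RMul (RNat (NConst 2)) (RAdd (RVar ''a'') (RVar ''eta_plus'')))"

definition C2_exp :: rexp where
  "C2_exp = RDiv (RVar ''b'')
     (RMul (RNat (NConst 2)) (RAdd (RVar ''a'') (RVar ''eta_plus'')))"

text \<open>With all unknowns on the left, the diagonal is 1 and the off-diagonal entry is
  \<open>- C1\<close> divided by the larger of the two indices. Subtraction from 0 stands for the
  sign.\<close>

definition sys_matrix :: rexp where
  "sys_matrix =
     RIf (BNatLess (NVar ''i'') (NVar ''j''))
       (RSub (RNat (NConst 0)) (RDiv C1_exp (RNat (NVar ''j''))))
       (RIf (BNatLess (NVar ''j'') (NVar ''i''))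
         (RSub (RNat (NConst 0)) (RDiv C1_exp (RNat (NVar ''i''))))
         (RNat (NConst 1)))"

definition sys_rhs :: "vname \<Rightarrow> rexp" where
  "sys_rhs k =
     RAdd
       (RMul C1_exp
         (RDiv (RAdd (RVar ''r'') (RMul (RNat (NSub (NVar k) (NConst 1))) (RVar ''pbar'')))
           (RNat (NVar ''i''))))
       C2_exp"

definition solve_sys :: "vname \<Rightarrow> vname \<Rightarrow> com" where
  "solve_sys y k = Solve ''f'' y ''i'' ''j'' (NVar k) (NVar ''T'') sys_matrix (sys_rhs k)"

text \<open>After a singular system the array \<open>y\<close> holds stale values, hence the test of the flag \<open>f\<close>.\<close>

definition scan :: com where
  "scan = While
     (BAnd (BNatLess (NConst 0) (NVar ''f'')) (BAnd (BNatLess (NVar ''i'') (NAdd (NVar ''T'') (NConst 1)))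
       (BAnd (BNot (BRealLess (RArr ''y'' (NVar ''i'')) (RNat (NConst 0))))
             (BNot (BRealLess (RVar ''pbar'') (RArr ''y'' (NVar ''i'')))))))
     (NSet ''i'' (NAdd (NVar ''i'') (NConst 1)))"

text \<open>The verdict on \<open>mid\<close> is read off the register \<open>i\<close>:
  \<open>scan\<close> leaves it above \<open>T\<close> exactly when every entry has passed.\<close>

definition bisect_body :: com where
  "bisect_body =
     Seq (NSet ''mid'' (NDiv (NAdd (NVar ''lo'') (NVar ''hi'')) (NConst 2)))
    (Seq (solve_sys ''y'' ''mid'')
    (Seq (NSet ''i'' (NVar ''mid''))
    (Seq scan
         (If (BNatLess (NVar ''T'') (NVar ''i''))
           (NSet ''hi'' (NVar ''mid''))
           (NSet ''lo'' (NAdd (NVar ''mid'') (NConst 1)))))))"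

definition bisect :: com where
  "bisect = While (BNatLess (NVar ''lo'') (NVar ''hi'')) bisect_body"

definition fill :: com where
  "fill = While (BNatLess (NVar ''i'') (NVar ''lo''))
     (Seq (ASet ''p'' (NVar ''i'') (RVar ''pbar''))
          (NSet ''i'' (NAdd (NVar ''i'') (NConst 1))))"

text \<open>The system at the final index is solved once more, since the last index tested may be a
  different one. The curve's recursion is never executed: \<open>fill\<close> only overwrites the
  cells before that index.\<close>

definition price_program :: com where
  "price_program =
     Seq (NSet ''lo'' (NConst 1))
    (Seq (NSet ''hi'' (NVar ''T''))
    (Seq bisect
    (Seq (solve_sys ''p'' ''lo'')
    (Seq (NSet ''i'' (NConst 1))
         fill))))"

section \<open>Effect and cost of the elementary loops\<close>

lemma scan_exec:
  assumes "idx s ''i'' \<le> idx s ''T'' + 1"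
  shows "\<exists>n j. exec scan s [] n (s\<lparr>idx := (idx s)(''i'' := j)\<rparr>)
    \<and> n \<le> 2 * (idx s ''T'' + 1 - idx s ''i'') + 1
    \<and> (idx s ''T'' < j \<longleftrightarrow>
        (\<forall>t\<in>{idx s ''i''..idx s ''T''}. 0 < idx s ''f'' \<and> arr s ''y'' t \<in> {0..reg s ''pbar''}))"
  using assms
proof (induction "idx s ''T'' + 1 - idx s ''i''" arbitrary: s rule: less_induct)
  case less
  let ?i = "idx s ''i''" and ?T = "idx s ''T''"
  define s1 where "s1 = s\<lparr>idx := (idx s)(''i'' := ?i + 1)\<rparr>"
  show ?case
  proof (cases "?i \<le> ?T \<and> 0 < idx s ''f'' \<and> arr s ''y'' ?i \<in> {0..reg s ''pbar''}")
    case True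
    have "\<exists>n j. exec scan s1 [] n (s1\<lparr>idx := (idx s1)(''i'' := j)\<rparr>)
        \<and> n \<le> 2 * (idx s1 ''T'' + 1 - idx s1 ''i'') + 1
        \<and> (idx s1 ''T'' < j \<longleftrightarrow> (\<forall>t\<in>{idx s1 ''i''..idx s1 ''T''}.
             0 < idx s1 ''f'' \<and> arr s1 ''y'' t \<in> {0..reg s1 ''pbar''}))"
      using True by (intro less.hyps) (auto simp: s1_def)
    then obtain n j where n: "exec scan s1 [] n (s\<lparr>idx := (idx s)(''i'' := j)\<rparr>)"
        "n \<le> 2 * (?T - ?i) + 1"
        "?T < j \<longleftrightarrow> (\<forall>t\<in>{Suc ?i..?T}. 0 < idx s ''f'' \<and> arr s ''y'' t \<in> {0..reg s ''pbar''})"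
      by (auto simp: s1_def)
    have "exec scan s ([] @ []) (1 + n + 1) (s\<lparr>idx := (idx s)(''i'' := j)\<rparr>)"
      unfolding scan_def
    proof (rule exec.WhileTrue)
      show "exec (NSet ''i'' (NAdd (NVar ''i'') (NConst 1))) s [] 1 s1"
        using exec.NSet[of "''i''" "NAdd (NVar ''i'') (NConst 1)" s] by (simp add: s1_def)
    qed (use True n(1) in \<open>auto simp: scan_def\<close>)
    moreover have "?T < j \<longleftrightarrow> (\<forall>t\<in>{?i..?T}. 0 < idx s ''f'' \<and> arr s ''y'' t \<in> {0..reg s ''pbar''})"
    proof -
      have "{?i..?T} = insert ?i {Suc ?i..?T}" using True by auto
      then show ?thesis using True n(3) by auto
    qed
    moreover have "1 + n + 1 \<le> 2 * (?T + 1 - ?i) + 1" using n(2) True by (simp add: Suc_diff_le)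
    ultimately show ?thesis by (metis append_Nil)
  next
    case False
    have "exec scan s [] 1 s"
      unfolding scan_def by (rule exec.WhileFalse) (use False in auto)
    moreover have "s = s\<lparr>idx := (idx s)(''i'' := ?i)\<rparr>" by simp
    moreover have "?T < ?i \<longleftrightarrow> (\<forall>t\<in>{?i..?T}. 0 < idx s ''f'' \<and> arr s ''y'' t \<in> {0..reg s ''pbar''})"
      using False by (cases "?i \<le> ?T") auto
    ultimately show ?thesis
      by (intro exI[of _ 1] exI[of _ ?i] conjI) (simp_all only: le_add2)
  qed
qed

text \<open>Each cell costs three steps: two assignments and one loop test.\<close>

lemma fill_exec:
  "\<exists>n s'. exec fill s [] n s' \<and> n \<le> 3 * (idx s ''lo'' - idx s ''i'') + 1
    \<and> arr s' ''p'' = (\<lambda>t. if idx s ''i'' \<le> t \<and> t < idx s ''lo'' then reg s ''pbar'' else arr s ''p'' t)"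
proof (induction "idx s ''lo'' - idx s ''i''" arbitrary: s)
  case 0
  have "exec fill s [] 1 s"
    unfolding fill_def by (rule exec.WhileFalse) (use 0 in auto)
  then show ?case using 0 by (intro exI[of _ 1] exI[of _ s]) (auto simp: fun_eq_iff)
next
  case (Suc x)
  let ?i = "idx s ''i''" and ?lo = "idx s ''lo''"
  have lt: "?i < ?lo" using Suc.hyps by simp
  define s1 where "s1 = s\<lparr>arr := (arr s)(''p'' := (arr s ''p'')(?i := reg s ''pbar''))\<rparr>"
  define s2 where "s2 = s1\<lparr>idx := (idx s1)(''i'' := ?i + 1)\<rparr>"
  have s2: "idx s2 ''lo'' = ?lo" "idx s2 ''i'' = Suc ?i" "reg s2 ''pbar'' = reg s ''pbar''"
    by (simp_all add: s2_def s1_def)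
  have "x = idx s2 ''lo'' - idx s2 ''i''" using Suc.hyps(2) s2 by simp
  from Suc.hyps(1)[OF this] obtain n s' where n: "exec fill s2 [] n s'" "n \<le> 3 * (?lo - Suc ?i) + 1"
      "arr s' ''p'' = (\<lambda>t. if Suc ?i \<le> t \<and> t < ?lo then reg s ''pbar'' else arr s2 ''p'' t)"
    unfolding s2 by blast
  have "exec fill s (([] @ []) @ []) ((1 + 1) + n + 1) s'"
    unfolding fill_def
  proof (rule exec.WhileTrue)
    show "exec (Seq (ASet ''p'' (NVar ''i'') (RVar ''pbar''))
        (NSet ''i'' (NAdd (NVar ''i'') (NConst 1)))) s ([] @ []) (1 + 1) s2"
    proof (rule exec.Seq)
      show "exec (ASet ''p'' (NVar ''i'') (RVar ''pbar'')) s [] 1 s1"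
        using exec.ASet[of "''p''" "NVar ''i''" "RVar ''pbar''" s] by (simp add: s1_def)
      show "exec (NSet ''i'' (NAdd (NVar ''i'') (NConst 1))) s1 [] 1 s2"
        using exec.NSet[of "''i''" "NAdd (NVar ''i'') (NConst 1)" s1] by (simp add: s2_def s1_def)
    qed
  qed (use lt n(1) in \<open>auto simp: fill_def\<close>)
  moreover have "arr s' ''p'' = (\<lambda>t. if ?i \<le> t \<and> t < ?lo then reg s ''pbar'' else arr s ''p'' t)"
    using n(3) lt by (auto simp: s2_def s1_def fun_eq_iff)
  ultimately show ?case
    using n(2) lt by (intro exI[of _ "n + 3"] exI[of _ s']) (simp add: numeral_3_eq_3)
qed

section \<open>Correctness and cost of the program\<close>

context pricing
begin

definition holds_input :: "state \<Rightarrow> bool" where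
  "holds_input s \<longleftrightarrow> idx s ''T'' = T \<and> reg s ''a'' = a \<and> reg s ''b'' = b \<and>
     reg s ''eta_plus'' = \<eta> \<and> reg s ''pbar'' = pbar \<and> reg s ''r'' = r"

text \<open>Each row is split at the diagonal. The register \<open>k\<close> must differ from
  \<open>i\<close> and \<open>j\<close>, which \<open>Solve\<close> overrides while evaluating the
  entries.\<close>

lemma lin_sol_iff:
  assumes s: "holds_input s" and k: "k \<notin> {''i'', ''j''}" "1 \<le> idx s k"
  shows "lin_sol s ''i'' ''j'' (idx s k) (idx s ''T'') sys_matrix (sys_rhs k) y \<longleftrightarrow>
    solves_S a b \<eta> pbar T r (idx s k) y"
proof -
  have "(\<Sum>l\<in>{idx s k..T}. rval sys_matrix (s\<lparr>idx := (idx s)(''i'' := t, ''j'' := l)\<rparr>) * y l)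
        = rval (sys_rhs k) (s\<lparr>idx := (idx s)(''i'' := t)\<rparr>) \<longleftrightarrow>
      y t = step (hist (idx s k)) (idx s k) y t" if t: "t \<in> {idx s k..T}" for t
  proof -
    let ?A = "\<lambda>l. rval sys_matrix (s\<lparr>idx := (idx s)(''i'' := t, ''j'' := l)\<rparr>)"
    have A: "?A l = (if t < l then - (C1 a \<eta> / real l) else if l < t then - (C1 a \<eta> / real t) else 1)" for l
      using s by (simp add: sys_matrix_def C1_exp_def C1_def holds_input_def)
    have "{idx s k..T} = {idx s k..<t} \<union> {t..T}" using t by auto
    then have e1: "(\<Sum>l\<in>{idx s k..T}. ?A l * y l)
        = (\<Sum>l\<in>{idx s k..<t}. ?A l * y l) + (\<Sum>l\<in>{t..T}. ?A l * y l)"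
      by (simp only:) (rule sum.union_disjoint, auto)
    have e2: "(\<Sum>l\<in>{t..T}. ?A l * y l) = ?A t * y t + (\<Sum>l\<in>{t+1..T}. ?A l * y l)"
      unfolding Suc_eq_plus1[symmetric] by (rule sum.atLeast_Suc_atMost) (use t in auto)
    have "(\<Sum>l\<in>{idx s k..<t}. ?A l * y l) = (\<Sum>l\<in>{idx s k..<t}. - (C1 a \<eta> / real t) * y l)"
      by (intro sum.cong) (auto simp: A)
    then have e3: "(\<Sum>l\<in>{idx s k..<t}. ?A l * y l) = - (C1 a \<eta> * ((\<Sum>l\<in>{idx s k..<t}. y l) / real t))"
      by (simp add: sum_distrib_left sum_divide_distrib sum_negf)
    have "(\<Sum>l\<in>{t+1..T}. ?A l * y l) = (\<Sum>l\<in>{t+1..T}. - (C1 a \<eta> * (y l / real l)))"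
      by (intro sum.cong) (auto simp: A)
    then have e4: "(\<Sum>l\<in>{t+1..T}. ?A l * y l) = - (C1 a \<eta> * (\<Sum>l\<in>{t+1..T}. y l / real l))"
      by (simp only: sum_distrib_left sum_negf)
    have e5: "?A t * y t = y t" by (simp add: A)
    have lhs: "(\<Sum>l\<in>{idx s k..T}. ?A l * y l) =
        y t - C1 a \<eta> * ((\<Sum>l\<in>{idx s k..<t}. y l) / real t) - C1 a \<eta> * (\<Sum>l\<in>{t+1..T}. y l / real l)"
      unfolding e1 e2 e3 e4 e5 by linarith
    have "real (idx s k - 1) = real (idx s k) - 1" using k(2) by simp
    then have rhs: "rval (sys_rhs k) (s\<lparr>idx := (idx s)(''i'' := t)\<rparr>)
        = C1 a \<eta> * (hist (idx s k) / real t) + C2 a b \<eta>"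
      using s k(1) by (simp add: sys_rhs_def C1_exp_def C2_exp_def C1_def C2_def holds_input_def hist_def)
    show ?thesis
      unfolding lhs rhs step_def add_divide_distrib distrib_left by linarith
  qed
  then show ?thesis
    using s k(2) by (simp add: lin_sol_def solves_S_iff holds_input_def)
qed

lemma unique_lin_sol_if_box:
  assumes s: "holds_input s" and k: "k \<notin> {''i'', ''j''}" "1 \<le> idx s k"
    and box: "box_solves_S a b \<eta> pbar T r (idx s k) y"
  shows "unique_lin_sol s ''i'' ''j'' (idx s k) (idx s ''T'') sys_matrix (sys_rhs k) y"
  unfolding unique_lin_sol_def lin_sol_iff[OF s k]
proof (intro conjI allI impI ballI)
  show "solves_S a b \<eta> pbar T r (idx s k) y" using box by (simp add: box_solves_S_def)
  fix z l assume "solves_S a b \<eta> pbar T r (idx s k) z" "l \<in> {idx s k..idx s ''T''}"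
  then show "z l = y l" using box_solution_unique[OF k(2) box] s by (simp add: holds_input_def)
qed

text \<open>In the regular case a box solution, if there is one, is the solution returned, so
  checking the entries decides solvability. In the singular case a box solution cannot exist, since
  it would be the unique solution.\<close>

lemma solve_sys_exec:
  assumes s: "holds_input s" and k: "k \<notin> {''i'', ''j''}" "1 \<le> idx s k"
  shows "\<exists>f z. exec (solve_sys y k) s [T + 1 - idx s k] 1
      (s\<lparr>idx := (idx s)(''f'' := f), arr := (arr s)(y := z)\<rparr>)
    \<and> (solvable (idx s k) \<longleftrightarrow> 0 < f \<and> (\<forall>t\<in>{idx s k..T}. z t \<in> {0..pbar}))
    \<and> (solvable (idx s k) \<longrightarrow> box_solves_S a b \<eta> pbar T r (idx s k) z)"
proof -
  have T: "idx s ''T'' = T" using s by (simp add: holds_input_def)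
  let ?u = "unique_lin_sol s ''i'' ''j'' (idx s k) T sys_matrix (sys_rhs k)"
  show ?thesis
  proof (cases "\<exists>w. ?u w")
    case True
    then obtain w where w: "?u w" ..
    define z where "z = (\<lambda>l. if l \<in> {idx s k..T} then w l else arr s y l)"
    have ex: "exec (solve_sys y k) s [T + 1 - idx s k] 1
        (s\<lparr>idx := (idx s)(''f'' := 1), arr := (arr s)(y := z)\<rparr>)"
      using exec.SolveRegular[of s "''i''" "''j''" "NVar k" "NVar ''T''" sys_matrix "sys_rhs k" w "''f''" y] w
      by (simp add: solve_sys_def T z_def)
    \<comment> \<open>Applying monotonicity in both directions shows that \<open>step\<close> sees
      only the cells from \<open>k\<close> to \<open>T\<close>.\<close>
    have zw: "step K (idx s k) z t = step K (idx s k) w t" if "t \<in> {idx s k..T}" for K t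
      using that by (auto intro!: antisym step_mono simp: z_def)
    have "solves_S a b \<eta> pbar T r (idx s k) w"
      using w lin_sol_iff[OF s k] by (simp add: unique_lin_sol_def T)
    then have z: "solves_S a b \<eta> pbar T r (idx s k) z"
      using k(2) by (simp add: solves_S_iff zw) (simp add: z_def)
    have *: "box_solves_S a b \<eta> pbar T r (idx s k) z" if solv: "solvable (idx s k)"
    proof -
      obtain p where p: "box_solves_S a b \<eta> pbar T r (idx s k) p"
        using solv by (auto simp: solvable_def)
      show ?thesis
        using box_solution_unique[OF k(2) p z] p z by (simp add: box_solves_S_def)
    qed
    then have "solvable (idx s k) \<longleftrightarrow> (\<forall>t\<in>{idx s k..T}. z t \<in> {0..pbar})"
      using z by (auto simp: box_solves_S_def solvable_def)
    with ex * show ?thesis by (intro exI[of _ 1] exI[of _ z]) simp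
  next
    case False
    then have "\<not> solvable (idx s k)"
      using unique_lin_sol_if_box[OF s k] T by (auto simp: solvable_def)
    moreover have "exec (solve_sys y k) s [T + 1 - idx s k] 1 (s\<lparr>idx := (idx s)(''f'' := 0)\<rparr>)"
      using exec.SolveSingular[of s "''i''" "''j''" "NVar k" "NVar ''T''" sys_matrix "sys_rhs k" "''f''" y] False
      by (simp add: solve_sys_def T)
    ultimately show ?thesis by (intro exI[of _ 0] exI[of _ "arr s y"]) simp
  qed
qed

text \<open>The loop invariant: once \<open>lo = hi\<close>, this index is the least solvable
  one.\<close>

definition bracket :: "state \<Rightarrow> bool" where
  "bracket s \<longleftrightarrow> holds_input s \<and> 1 \<le> idx s ''lo'' \<and> idx s ''lo'' \<le> idx s ''hi'' \<and> idx s ''hi'' \<le> T \<and>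
     solvable (idx s ''hi'') \<and> (\<forall>l. 1 \<le> l \<and> l < idx s ''lo'' \<longrightarrow> \<not> solvable l)"

text \<open>Since \<open>mid \<ge> 1\<close>, the scan takes at most \<open>2 * T + 1\<close> steps;
  the other five are two assignments, the solver call and the conditional.\<close>

lemma bisect_body_exec:
  assumes "bracket s" and lt: "idx s ''lo'' < idx s ''hi''"
  shows "\<exists>d n s'. exec bisect_body s [d] n s' \<and> d \<le> T \<and> n \<le> 2 * T + 6 \<and> bracket s' \<and>
    idx s' ''hi'' - idx s' ''lo'' \<le> (idx s ''hi'' - idx s ''lo'') div 2"
proof -
  note br = assms(1)[unfolded bracket_def]
  define mid where "mid = (idx s ''lo'' + idx s ''hi'') div 2"
  have mid: "idx s ''lo'' \<le> mid" "mid < idx s ''hi''" "1 \<le> mid" "mid \<le> T"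
    using br lt by (auto simp: mid_def)
  define s1 where "s1 = s\<lparr>idx := (idx s)(''mid'' := mid)\<rparr>"
  have e1: "exec (NSet ''mid'' (NDiv (NAdd (NVar ''lo'') (NVar ''hi'')) (NConst 2))) s [] 1 s1"
    using exec.NSet[of "''mid''" "NDiv (NAdd (NVar ''lo'') (NVar ''hi'')) (NConst 2)" s]
    by (simp add: s1_def mid_def)
  have s1: "holds_input s1" "idx s1 ''mid'' = mid" using br by (simp_all add: s1_def holds_input_def)
  obtain f z where e2: "exec (solve_sys ''y'' ''mid'') s1 [T + 1 - mid] 1
      (s1\<lparr>idx := (idx s1)(''f'' := f), arr := (arr s1)(''y'' := z)\<rparr>)"
    and solv: "solvable mid \<longleftrightarrow> 0 < f \<and> (\<forall>t\<in>{mid..T}. z t \<in> {0..pbar})"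
    using solve_sys_exec[OF s1(1), of "''mid''" "''y''"] mid s1(2) by auto
  define s2 where "s2 = s1\<lparr>idx := (idx s1)(''f'' := f), arr := (arr s1)(''y'' := z)\<rparr>"
  define s3 where "s3 = s2\<lparr>idx := (idx s2)(''i'' := mid)\<rparr>"
  have e3: "exec (NSet ''i'' (NVar ''mid'')) s2 [] 1 s3"
    using exec.NSet[of "''i''" "NVar ''mid''" s2] s1(2) by (simp add: s3_def s2_def)
  have s3: "idx s3 ''T'' = T" "idx s3 ''i'' = mid" "idx s3 ''f'' = f" "arr s3 ''y'' = z" "reg s3 ''pbar'' = pbar"
    using s1 by (simp_all add: s3_def s2_def holds_input_def)
  obtain n j where e4: "exec scan s3 [] n (s3\<lparr>idx := (idx s3)(''i'' := j)\<rparr>)"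
    and n: "n \<le> 2 * (T + 1 - mid) + 1" and j: "T < j \<longleftrightarrow> solvable mid"
    using scan_exec[of s3] mid solv unfolding s3 by fastforce
  define s4 where "s4 = s3\<lparr>idx := (idx s3)(''i'' := j)\<rparr>"
  define s5 where "s5 = (if solvable mid then s4\<lparr>idx := (idx s4)(''hi'' := mid)\<rparr>
    else s4\<lparr>idx := (idx s4)(''lo'' := mid + 1)\<rparr>)"
  have s4: "idx s4 ''T'' = T" "idx s4 ''i'' = j" "idx s4 ''mid'' = mid"
      "idx s4 ''lo'' = idx s ''lo''" "idx s4 ''hi'' = idx s ''hi''" "holds_input s4"
    using br by (simp_all add: s4_def s3_def s2_def s1_def holds_input_def)
  have e5: "exec (If (BNatLess (NVar ''T'') (NVar ''i'')) (NSet ''hi'' (NVar ''mid''))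
      (NSet ''lo'' (NAdd (NVar ''mid'') (NConst 1)))) s4 [] (1 + 1) s5"
  proof (cases "solvable mid")
    case True
    then show ?thesis
      using exec.NSet[of "''hi''" "NVar ''mid''" s4] j s4
      by (intro exec.IfTrue) (simp_all add: s5_def)
  next
    case False
    then show ?thesis
      using exec.NSet[of "''lo''" "NAdd (NVar ''mid'') (NConst 1)" s4] j s4
      by (intro exec.IfFalse) (simp_all add: s5_def)
  qed
  have "exec bisect_body s ([] @ [T + 1 - mid] @ [] @ [] @ []) (1 + (1 + (1 + (n + (1 + 1))))) s5"
    unfolding bisect_body_def
    using e1 e2 e3 e4 e5 unfolding s2_def[symmetric] s4_def[symmetric] by (intro exec.Seq)
  then have "exec bisect_body s [T + 1 - mid] (n + 5) s5" by (simp add: eval_nat_numeral)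
  moreover have "n + 5 \<le> 2 * T + 6" using n mid by simp
  moreover have "bracket s5"
  proof (cases "solvable mid")
    case True
    then show ?thesis
      using br s4 mid by (simp add: bracket_def s5_def holds_input_def)
  next
    case False
    \<comment> \<open>If \<open>mid\<close> fails, every smaller index fails too, because
      solvability passes upwards.\<close>
    then have "\<not> solvable l" if "1 \<le> l" "l \<le> mid" for l
      using solvable_mono[OF that(1) _ that(2) mid(4)] by blast
    then show ?thesis
      using False br s4 mid by (simp add: bracket_def s5_def holds_input_def less_Suc_eq_le)
  qed
  moreover have "idx s5 ''hi'' - idx s5 ''lo'' \<le> (idx s ''hi'' - idx s ''lo'') div 2"
    using s4 mid by (auto simp: s5_def mid_def)
  ultimately show ?thesis using mid by (intro exI[of _ "T + 1 - mid"] exI[of _ "n + 5"] exI[of _ s5]) simp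
qed

text \<open>Each round halves the gap, so a gap below \<open>2 ^ m\<close> closes within
  \<open>m\<close> rounds, each costing the body plus one loop test.\<close>

lemma bisect_exec:
  assumes "bracket s" "idx s ''hi'' - idx s ''lo'' < 2 ^ m"
  shows "\<exists>ds n s'. exec bisect s ds n s' \<and> length ds \<le> m \<and> (\<forall>d\<in>set ds. d \<le> T) \<and>
    n \<le> m * (2 * T + 7) + 1 \<and> bracket s' \<and> idx s' ''lo'' = idx s' ''hi''"
  using assms
proof (induction m arbitrary: s)
  case 0
  then have eq: "idx s ''lo'' = idx s ''hi''" by (simp add: bracket_def)
  then have "exec bisect s [] 1 s"
    unfolding bisect_def by (intro exec.WhileFalse) simp
  with eq 0 show ?case by (intro exI[of _ "[]"] exI[of _ 1] exI[of _ s]) simp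
next
  case (Suc m)
  show ?case
  proof (cases "idx s ''lo'' < idx s ''hi''")
    case True
    obtain d n s1 where body: "exec bisect_body s [d] n s1" "d \<le> T" "n \<le> 2 * T + 6" "bracket s1"
        "idx s1 ''hi'' - idx s1 ''lo'' \<le> (idx s ''hi'' - idx s ''lo'') div 2"
      using bisect_body_exec[OF Suc.prems(1) True] by blast
    have "idx s1 ''hi'' - idx s1 ''lo'' < 2 ^ m" using body(5) Suc.prems(2) by simp
    then obtain ds n' s' where rest: "exec bisect s1 ds n' s'" "length ds \<le> m" "\<forall>d\<in>set ds. d \<le> T"
        "n' \<le> m * (2 * T + 7) + 1" "bracket s'" "idx s' ''lo'' = idx s' ''hi''"
      using Suc.IH[OF body(4)] by blast
    have "exec bisect s ([d] @ ds) (n + n' + 1) s'"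
      unfolding bisect_def
      by (rule exec.WhileTrue) (use True body(1) rest(1) in \<open>simp_all add: bisect_def\<close>)
    with body rest show ?thesis
      by (intro exI[of _ "[d] @ ds"] exI[of _ "n + n' + 1"] exI[of _ s']) simp
  next
    case False
    then have eq: "idx s ''lo'' = idx s ''hi''" using Suc.prems by (simp add: bracket_def)
    then have "exec bisect s [] 1 s"
      unfolding bisect_def by (intro exec.WhileFalse) simp
    with eq Suc.prems show ?thesis by (intro exI[of _ "[]"] exI[of _ 1] exI[of _ s]) simp
  qed
qed

text \<open>The final solver call accounts for the \<open>+ 1\<close>; filling the prefix
  contributes the term \<open>3 * T\<close>.\<close>

lemma price_program_correct:
  assumes "T \<le> 2 ^ m"
  shows "\<exists>ds n. computes_price_curve price_program a b \<eta> \<eta>m pbar T r ds n \<and> length ds \<le> m + 1 \<and>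
    (\<forall>d\<in>set ds. d \<le> T) \<and> n \<le> m * (2 * T + 7) + 3 * T + 6"
proof -
  define s where "s = input_state a b \<eta> \<eta>m pbar T r"
  define s1 where "s1 = s\<lparr>idx := (idx s)(''lo'' := 1)\<rparr>"
  define s2 where "s2 = s1\<lparr>idx := (idx s1)(''hi'' := T)\<rparr>"
  have e1: "exec (NSet ''lo'' (NConst 1)) s [] 1 s1"
    using exec.NSet[of "''lo''" "NConst 1" s] by (simp add: s1_def)
  have e2: "exec (NSet ''hi'' (NVar ''T'')) s1 [] 1 s2"
    using exec.NSet[of "''hi''" "NVar ''T''" s1] by (simp add: s2_def s1_def s_def input_state_def)
  have s2: "idx s2 ''lo'' = 1" "idx s2 ''hi'' = T" "holds_input s2"
    by (simp_all add: s2_def s1_def s_def input_state_def holds_input_def)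
  have "bracket s2"
    using s2 T_pos solvable_T by (simp add: bracket_def)
  moreover have "idx s2 ''hi'' - idx s2 ''lo'' < 2 ^ m"
    using s2 assms T_pos by simp
  ultimately obtain ds n3 s3 where e3: "exec bisect s2 ds n3 s3"
    and ds: "length ds \<le> m" "\<forall>d\<in>set ds. d \<le> T"
    and n3: "n3 \<le> m * (2 * T + 7) + 1" and s3: "bracket s3" "idx s3 ''lo'' = idx s3 ''hi''"
    using bisect_exec by blast
  define k where "k = idx s3 ''lo''"
  have k: "1 \<le> k" "k \<le> T" "solvable k" "\<And>l. 1 \<le> l \<Longrightarrow> l < k \<Longrightarrow> \<not> solvable l"
    and in3: "holds_input s3"
    using s3 by (simp_all add: bracket_def k_def)
  obtain f z where e4: "exec (solve_sys ''p'' ''lo'') s3 [T + 1 - k] 1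
      (s3\<lparr>idx := (idx s3)(''f'' := f), arr := (arr s3)(''p'' := z)\<rparr>)"
    and z: "box_solves_S a b \<eta> pbar T r k z"
    using solve_sys_exec[OF in3, of "''lo''" "''p''"] k unfolding k_def[symmetric] by auto
  define s4 where "s4 = s3\<lparr>idx := (idx s3)(''f'' := f), arr := (arr s3)(''p'' := z)\<rparr>"
  define s5 where "s5 = s4\<lparr>idx := (idx s4)(''i'' := 1)\<rparr>"
  have e5: "exec (NSet ''i'' (NConst 1)) s4 [] 1 s5"
    using exec.NSet[of "''i''" "NConst 1" s4] by (simp add: s5_def)
  have s5: "idx s5 ''lo'' = k" "idx s5 ''i'' = 1" "arr s5 ''p'' = z" "reg s5 ''pbar'' = pbar"
    using in3 by (simp_all add: s5_def s4_def k_def holds_input_def)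
  obtain n6 s6 where e6: "exec fill s5 [] n6 s6" and n6: "n6 \<le> 3 * (k - 1) + 1"
    and p: "arr s6 ''p'' = (\<lambda>t. if 1 \<le> t \<and> t < k then pbar else z t)"
    using fill_exec[of s5] unfolding s5 by blast
  have "exec price_program s ([] @ [] @ ds @ [T + 1 - k] @ [] @ []) (1 + (1 + (n3 + (1 + (1 + n6))))) s6"
    unfolding price_program_def
    using e1 e2 e3 e4 e5 e6 unfolding s4_def[symmetric] by (intro exec.Seq)
  moreover have "arr s6 ''p'' t = price_curve a b \<eta> pbar T r t" if "t \<in> {1..T}" for t
    using price_curve_eq[OF k(1,2) t_dagger_eq[OF k] z that] that by (simp add: p)
  ultimately have "computes_price_curve price_program a b \<eta> \<eta>m pbar T r (ds @ [T + 1 - k])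
      (1 + (1 + (n3 + (1 + (1 + n6)))))"
    unfolding computes_price_curve_def s_def[symmetric] by auto
  moreover have "1 + (1 + (n3 + (1 + (1 + n6)))) \<le> m * (2 * T + 7) + 3 * T + 6"
    using n3 n6 k by simp
  ultimately show ?thesis using ds k
    by (intro exI[of _ "ds @ [T + 1 - k]"] exI conjI) auto
qed

end

section \<open>From the model assumptions to the asymptotic bounds\<close>

lemma pricing_model_imp_pricing:
  assumes "pricing_model a b \<eta>p \<eta>m pbar c0" "T \<ge> 1" "r \<in> {0..pbar}"
  shows "pricing a b \<eta>p pbar T r"
proof
  have a: "a > 0" "\<eta>p \<ge> 0" "\<eta>m \<ge> 0" "c0 > 0" "b / (2 * a) \<le> pbar - c0" and r: "0 \<le> r" "r \<le> pbar"
    and D: "\<And>p q. p \<in> {0..pbar} \<Longrightarrow> q \<in> {0..pbar} \<Longrightarrow> demand a b \<eta>p \<eta>m p q \<ge> 0"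
    using assms by (auto simp: pricing_model_def)
  show b: "b < 2 * a * pbar" using a by (simp add: field_simps) (smt (verit) mult_pos_pos)
  \<comment> \<open>Demand at price 0 and reference 0 gives \<open>b \<ge> 0\<close>, hence
    \<open>pbar > 0\<close>; then demand at \<open>pbar\<close> with reference 0 forces
    \<open>b > 0\<close>.\<close>
  have "0 \<le> b" using D[of 0 0] r by (simp add: demand_def)
  then have "0 \<le> b / (2 * a)" using a by simp
  then have pbar: "0 < pbar" using a by linarith
  have "a * pbar + \<eta>m * pbar \<le> b" using D[of pbar 0] pbar by (simp add: demand_def)
  moreover have "0 < a * pbar" "0 \<le> \<eta>m * pbar" using a pbar by simp_all
  ultimately show "0 < b" by linarith
qed (use assms in \<open>auto simp: pricing_model_def\<close>)

text \<open>This absorbs the additive constant in the number of solves; the comparison starts at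
  \<open>T = 2\<close>, as the logarithm vanishes at 1.\<close>

lemma one_bigo_ln: "(\<lambda>_. 1) \<in> O(\<lambda>T::nat. ln (real T))"
proof (rule bigoI[of _ "1 / ln 2"])
  show "\<forall>\<^sub>F T::nat in sequentially. norm (1::real) \<le> 1 / ln 2 * norm (ln (real T))"
    using eventually_ge_at_top[of 2] by eventually_elim (simp add: field_simps)
qed

theorem proposition3:
  shows "\<exists>solves steps :: nat \<Rightarrow> real.
     solves \<in> O(\<lambda>T. ln (real T)) \<and>
     steps \<in> O(\<lambda>T. real T * ln (real T)) \<and>
     (\<forall>\<eta>p \<eta>m :: real. \<eta>p \<ge> 0 \<and> \<eta>m \<ge> 0 \<longrightarrow>
       (\<exists>P :: com.
         \<forall>(a :: real) (b :: real) (pbar :: real) (c0 :: real) (T :: nat) (r :: real).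
           pricing_model a b \<eta>p \<eta>m pbar c0 \<and> T \<ge> 1 \<and> r \<in> {0..pbar} \<longrightarrow>
           (\<exists>ds n. computes_price_curve P a b \<eta>p \<eta>m pbar T r ds n \<and>
                   real (length ds) \<le> solves T \<and>
                   (\<forall>d\<in>set ds. d \<le> T) \<and>
                   real n \<le> steps T)))"
proof -
  \<comment> \<open>With \<open>m\<close> the rounded-up binary logarithm of \<open>T\<close>, the
    bound \<open>m + 1\<close> is at most \<open>log 2 T + 2\<close>.\<close>
  define solves :: "nat \<Rightarrow> real" where "solves T = log 2 (real T) + 2" for T
  \<comment> \<open>For \<open>T \<ge> 1\<close> both \<open>2 * T + 7\<close> and
    \<open>3 * T + 6\<close> are at most \<open>9 * T\<close>, so \<open>9 * T * (m + 1)\<close>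
    steps suffice; the factor 18 leaves room.\<close>
  define steps :: "nat \<Rightarrow> real" where "steps T = 18 * (real T * solves T)" for T
  have "(\<lambda>T. 1 / ln 2 * ln (real T) + 2 * 1) \<in> O(\<lambda>T. ln (real T))"
    by (intro sum_in_bigo landau_o.big.cmult_in_iff[THEN iffD2] one_bigo_ln) simp_all
  then have solves: "solves \<in> O(\<lambda>T. ln (real T))"
    by (simp add: solves_def[abs_def] log_def)
  then have "(\<lambda>T. real T * solves T) \<in> O(\<lambda>T. real T * ln (real T))"
    by (intro landau_o.big.mult) simp_all
  then have steps: "steps \<in> O(\<lambda>T. real T * ln (real T))"
    by (simp add: steps_def[abs_def])
  \<comment> \<open>One program serves every pair of parameters, since it reads
    \<open>eta_plus\<close> from its input register.\<close>
  have run: "\<exists>ds n. computes_price_curve price_program a b \<eta>p \<eta>m pbar T r ds n \<and>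
        real (length ds) \<le> solves T \<and> (\<forall>d\<in>set ds. d \<le> T) \<and> real n \<le> steps T"
    if model: "pricing_model a b \<eta>p \<eta>m pbar c0" "T \<ge> 1" "r \<in> {0..pbar}" for a b \<eta>p \<eta>m pbar c0 T r
  proof -
    interpret pricing a b \<eta>p pbar T r by (rule pricing_model_imp_pricing[OF model])
    define m where "m = nat \<lceil>log 2 (real T)\<rceil>"
    have log: "0 \<le> log 2 (real T)" using model(2) by simp
    have "real T = 2 powr log 2 (real T)" using model(2) by simp
    also have "\<dots> \<le> 2 powr real m" unfolding m_def using log by (intro powr_mono) linarith+
    also have "\<dots> = real (2 ^ m)" by (simp add: powr_realpow)
    finally have "T \<le> 2 ^ m" by (simp only: of_nat_le_iff)
    from price_program_correct[OF this, of \<eta>m] obtain ds n where run: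
      "computes_price_curve price_program a b \<eta>p \<eta>m pbar T r ds n" "length ds \<le> m + 1"
      "\<forall>d\<in>set ds. d \<le> T" "n \<le> m * (2 * T + 7) + 3 * T + 6" by blast
    have m: "real (m + 1) \<le> solves T" using log by (simp add: m_def solves_def) linarith
    have "m * (2 * T + 7) \<le> m * (9 * T)"
      using model(2) by (intro mult_left_mono) auto
    then have "n \<le> m * (9 * T) + 9 * T" using run(4) model(2) by linarith
    then have "n \<le> 18 * (T * (m + 1))" by (simp add: algebra_simps)
    then have "real n \<le> 18 * (real T * real (m + 1))"
      by (metis of_nat_le_iff of_nat_mult of_nat_numeral)
    also have "\<dots> \<le> steps T"
      unfolding steps_def using m by (intro mult_left_mono) auto
    finally have "real n \<le> steps T" .
    moreover have "real (length ds) \<le> solves T" using run(2) m by linarith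
    ultimately show ?thesis using run by blast
  qed
  show ?thesis
    using solves steps run by blast
qed

end
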